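(* Suppose $j\ge 1$, $k\ge 2$ and $n\ge \frac{j}{k-1}$ are integers. Then $\frac{j}{n}\binom{kn}{n+j}$ is the number of lattice paths of $n+j$ upsteps $(1,1)$ and $kn-(n+j)$ downsteps $(1,-1)$ which (i) start at $(0,-2i)$ for some $i\ge 0$, and (ii) have all interior $k$-divisible points (strictly) above the line through the origin of slope $-\frac{(k-2)n-2}{kn}$.
   Context: Here $i$ denotes an integer. A lattice path with $kn$ steps has $kn+1$ points (vertices), labeled $0,1,2,\ldots,kn$ from left to right: its initial point (label $0$), its terminal point (label $kn$), and $kn-1$ interior points. The $k$-divisible points of the path are those whose label is divisible by $k$; so the interior $k$-divisible points are those labeled $k,2k,\ldots,(n-1)k$.
   Formalization: The starting points (0,-2i) are restricted to 0 ≤ i < j instead of all i ≥ 0: otherwise there are infinitely many paths for n=1, and 11 instead of 10 for k=3, n=2, j=1; for n ≥ 2 and j ≥ k-1 the bound follows from (ii). *)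

theory Defs
  imports Complex_Main
begin

datatype step = Up | Down

fun step_vec :: "step \<Rightarrow> int \<times> int" where
  "step_vec Up = (1, 1)"
| "step_vec Down = (1, -1)"

text \<open>A lattice path is an initial point together with its list of steps. This determines the
  sequence of its points and is determined by it, so counting such pairs is counting paths;
  paths with different initial points are different.\<close>

type_synonym lattice_path = "(int \<times> int) \<times> step list"

abbreviation initial_point :: "lattice_path \<Rightarrow> int \<times> int" where
  "initial_point \<equiv> fst"

abbreviation path_steps :: "lattice_path \<Rightarrow> step list" where
  "path_steps \<equiv> snd"

definition path_point :: "lattice_path \<Rightarrow> nat \<Rightarrow> int \<times> int" where
  "path_point p m =
     (fst (initial_point p) + (\<Sum>s\<leftarrow>take m (path_steps p). fst (step_vec s)),
      snd (initial_point p) + (\<Sum>s\<leftarrow>take m (path_steps p). snd (step_vec s)))"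

text \<open>Labels run over \<open>0, \<dots>, length (path_steps p)\<close>; the first and the last are not interior.\<close>

definition interior_divisible_points :: "nat \<Rightarrow> lattice_path \<Rightarrow> (int \<times> int) set" where
  "interior_divisible_points k p =
     {path_point p m | m. 0 < m \<and> m < length (path_steps p) \<and> k dvd m}"

definition strictly_above_line :: "real \<Rightarrow> int \<times> int \<Rightarrow> bool" where
  "strictly_above_line \<mu> P \<longleftrightarrow> real_of_int (snd P) > \<mu> * real_of_int (fst P)"

definition line_slope :: "nat \<Rightarrow> nat \<Rightarrow> real" where
  "line_slope k n = - (((real k - 2) * real n - 2) / (real k * real n))"

text \<open>The paths that start at \<open>(0, -2i)\<close> with \<open>i\<close> prescribed. For the count to be
  \<open>(j / n) * (kn choose (n + j))\<close>, \<open>i\<close> must range over \<open>0 \<le> i < j\<close>, i.e. the terminal point must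
  lie on or above the line as well. With \<open>i \<ge> 0\<close> alone there are infinitely many paths for
  \<open>n = 1\<close> (no interior \<open>k\<close>-divisible points), and 11 instead of 10 for \<open>k = 3\<close>, \<open>n = 2\<close>, \<open>j = 1\<close>
  (the extra one starts at \<open>(0, -2)\<close> and has steps UUUDDD).\<close>

definition paths_from :: "nat \<Rightarrow> nat \<Rightarrow> nat \<Rightarrow> int \<Rightarrow> lattice_path set" where
  "paths_from j k n i =
     {p. int (count_list (path_steps p) Up) = int n + int j \<and>
         int (count_list (path_steps p) Down) = int k * int n - (int n + int j) \<and>
         initial_point p = (0, -2 * i) \<and>
         (\<forall>P \<in> interior_divisible_points k p. strictly_above_line (line_slope k n) P)}"

end

theory Submission
  imports Defs
begin

text \<open>Cut the steps of a path into \<open>n\<close> blocks of length \<open>k\<close> and let \<open>S m\<close> be the number of upsteps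
  in the first \<open>m\<close> blocks, minus \<open>m\<close>. Lying strictly above the line at label \<open>k m\<close> means
  \<open>S m > i + m / n\<close>, which for \<open>0 < m < n\<close> amounts to \<open>S m > i\<close>, since \<open>S m\<close> and \<open>i\<close> are integers
  (\<open>above_line_iff\<close>). So a list of steps \<open>w\<close> is counted once for each \<open>i\<close> with \<open>0 \<le> i < j\<close> and
  \<open>i < S m\<close> for all \<open>0 < m < n\<close>; denote by \<open>c w\<close> the number of such \<open>i\<close>. As \<open>S n = j\<close>, \<open>c w\<close> is the
  positive part of the minimum of \<open>S 1, \<dots>, S n\<close>.

  The number \<open>c w\<close> depends on \<open>w\<close> in a complicated way, but its sum over the \<open>n\<close> rotations of \<open>w\<close> by
  whole blocks is always \<open>j\<close> (\<open>sum_positive_margins\<close>). This is a version of the cycle lemma: if \<open>S\<close>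
  is extended by \<open>S (m + n) = S m + j\<close> and \<open>G t\<close> is the minimum of \<open>S\<close> after time \<open>t\<close>, then rotation
  by \<open>t\<close> blocks contributes \<open>G t - G (t - 1)\<close>, and the sum telescopes to \<open>G n - G 0 = j\<close>.
  Rotations permute the \<open>(kn choose (n + j))\<close> lists of steps, so \<open>n\<close> times the sum of all \<open>c w\<close> is
  \<open>j\<close> times that binomial coefficient.\<close>

section \<open>A cycle lemma\<close>

text \<open>The number of \<open>i\<close> at shift \<open>t\<close> is \<open>G t - min (G t) (S t)\<close>, where \<open>G t\<close> is the minimum of \<open>S\<close>
  over a period after \<open>t\<close>. Because \<open>S\<close> does not decrease over a period, that minimum is the minimum
  over all later times, so \<open>min (G t) (S t) = G (t - 1)\<close>.\<close>

lemma sum_positive_margins: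
  fixes S :: "nat \<Rightarrow> int" and n j :: nat
  assumes n: "n > 0" and period: "\<And>m. S (m + n) = S m + int j"
  shows "(\<Sum>t = 1..n. card {i::int. 0 \<le> i \<and> i < int j \<and> (\<forall>m. 0 < m \<and> m < n \<longrightarrow> i < S (t + m) - S t)}) = j"
proof -
  define G where "G t = Min (S ` {t + 1..t + n})" for t
  have less_G: "x < G t \<longleftrightarrow> (\<forall>m\<in>{t + 1..t + n}. x < S m)" for x t
    unfolding G_def using n by (subst Min_gr_iff) auto
  have step: "G t = min (S (t + 1)) (G (t + 1))" for t
  proof -
    have "{t + 1..t + n} \<union> {t + 1 + n} = insert (t + 1) {t + 1 + 1..t + 1 + n}"
      using n by auto
    moreover have "G t = Min (S ` ({t + 1..t + n} \<union> {t + 1 + n}))"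
    proof -
      have "G t \<le> S (t + 1)"
        unfolding G_def using n by (intro Min_le) auto
      also have "\<dots> \<le> S (t + 1 + n)"
        by (simp only: period)
      finally have "min (S (t + 1 + n)) (G t) = G t" by simp
      moreover have "Min (S ` ({t + 1..t + n} \<union> {t + 1 + n})) = min (S (t + 1 + n)) (G t)"
        unfolding G_def using n by (simp add: Min_insert)
      ultimately show ?thesis by simp
    qed
    ultimately show ?thesis
      using n by (simp add: G_def)
  qed
  have margin: "int (card {i::int. 0 \<le> i \<and> i < int j \<and> (\<forall>m. 0 < m \<and> m < n \<longrightarrow> i < S (t + m) - S t)})
      = G t - min (S t) (G t)" for t
  proof -
    \<comment> \<open>The bound \<open>i < j\<close> is the case \<open>m = n\<close> of the other condition.\<close>
    have "{i::int. 0 \<le> i \<and> i < int j \<and> (\<forall>m. 0 < m \<and> m < n \<longrightarrow> i < S (t + m) - S t)}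
        = {0..<G t - S t}"
    proof -
      have "(i < int j \<and> (\<forall>m. 0 < m \<and> m < n \<longrightarrow> i < S (t + m) - S t)) \<longleftrightarrow> i + S t < G t" for i :: int
      proof -
        have "{t + 1..t + n} = (\<lambda>m. t + m) ` {1..n}"
          by (simp add: add.commute)
        then have "(\<forall>m\<in>{t + 1..t + n}. i + S t < S m) \<longleftrightarrow> (\<forall>m. 0 < m \<and> m \<le> n \<longrightarrow> i + S t < S (t + m))"
          by (simp only: ball_simps) (auto simp: Suc_le_eq)
        also have "\<dots> \<longleftrightarrow> i + S t < S (t + n) \<and> (\<forall>m. 0 < m \<and> m < n \<longrightarrow> i + S t < S (t + m))"
          using n by (auto simp: le_less)
        finally show ?thesis
          unfolding less_G period by (simp add: less_diff_eq)
      qed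
      then show ?thesis by (auto simp: less_diff_eq)
    qed
    then show ?thesis by simp
  qed
  have "(\<Sum>t = 1..n. G t - min (S t) (G t)) = (\<Sum>t<n. G (Suc t) - G t)"
  proof -
    have "G (Suc t) - min (S (Suc t)) (G (Suc t)) = G (Suc t) - G t" for t
      using step[of t] by simp
    then show ?thesis
      by (simp add: sum.atLeast1_atMost_eq)
  qed
  also have "\<dots> = G n - G 0"
    by (rule sum_lessThan_telescope)
  also have "G n = G 0 + int j"
  proof -
    have "S ` {n + 1..n + n} = (\<lambda>x. x + int j) ` S ` {0 + 1..0 + n}"
    proof -
      have "{n + 1..n + n} = (\<lambda>m. m + n) ` {0 + 1..0 + n}"
        by (simp add: image_add_atLeastAtMost')
      then show ?thesis
        by (simp only: image_image period)
    qed
    then show ?thesis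
      unfolding G_def image_image using n by (simp add: Min_add_commute)
  qed
  finally show ?thesis
    unfolding margin[symmetric] of_nat_sum[symmetric] by (simp only: of_nat_eq_iff)
qed

section \<open>Lists of steps and their rotations\<close>

definition words :: "nat \<Rightarrow> nat \<Rightarrow> step list set" where
  "words N r = {w. length w = N \<and> count_list w Up = r}"

lemma count_Up_Down: "count_list w Up + count_list w Down = length w"
proof (induction w)
  case (Cons s w)
  then show ?case by (cases s) auto
qed simp

lemma count_list_rotate: "count_list (rotate s w) x = count_list w x"
proof -
  have "count_list (rotate1 v) x = count_list v x" for v :: "'a list"
    by (cases v) auto
  then show ?thesis
    by (induction s) (auto simp: rotate_Suc)
qed

lemma finite_words: "finite (words N r)"
proof -
  have "(UNIV :: step set) = {Up, Down}"
    using step.exhaust by auto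
  then have "finite (UNIV :: step set)"
    by (metis finite.simps)
  from finite_lists_length_eq[OF this, of N] show ?thesis
    by (rule finite_subset[rotated]) (auto simp: words_def)
qed

lemma card_words: "card (words N r) = N choose r"
proof (induction N arbitrary: r)
  case 0
  have "words 0 r = (if r = 0 then {[]} else {})"
    by (auto simp: words_def)
  then show ?case by (cases r) auto
next
  case (Suc N)
  have split: "words (Suc N) r = Cons Down ` words N r \<union> (if r = 0 then {} else Cons Up ` words N (r - 1))"
  proof (intro equalityI subsetI)
    fix w assume w: "w \<in> words (Suc N) r"
    then obtain s v where "w = s # v" by (cases w) (auto simp: words_def)
    with w show "w \<in> Cons Down ` words N r \<union> (if r = 0 then {} else Cons Up ` words N (r - 1))"
      by (cases s) (auto simp: words_def)
  qed (auto simp: words_def split: if_splits)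
  show ?case
  proof (cases r)
    case 0
    then show ?thesis unfolding split using Suc by (simp add: card_image)
  next
    case (Suc r')
    have "card (words (Suc N) r) = card (Cons Down ` words N r) + card (Cons Up ` words N r')"
      unfolding split using Suc by (simp, subst card_Un_disjoint) (auto simp: finite_words)
    then show ?thesis
      using Suc Suc.IH by (simp add: card_image)
  qed
qed

lemma bij_betw_rotate_words: "bij_betw (rotate s) (words N r) (words N r)"
proof -
  have inj: "inj_on (rotate s) (words N r)"
    unfolding rotate_def
    by (rule inj_on_subset[OF bij_is_inj[OF bij_fn[OF bij_rotate1]]]) simp
  have "rotate s ` words N r \<subseteq> words N r"
    by (auto simp: words_def count_list_rotate)
  from endo_inj_surj[OF finite_words this inj] inj show ?thesis
    by (simp add: bij_betw_def)
qed

text \<open>The upsteps among the first \<open>m\<close> steps of the infinite word obtained by repeating \<open>w\<close>. Every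
  rotation of \<open>w\<close> is a window of this word, so its prefix counts are differences of such numbers.\<close>

definition ups :: "step list \<Rightarrow> nat \<Rightarrow> nat" where
  "ups w m = (\<Sum>a<m. of_bool (w ! (a mod length w) = Up))"

lemma count_take: "m \<le> length w \<Longrightarrow> count_list (take m w) Up = (\<Sum>a<m. of_bool (w ! a = Up))"
  by (induction m) (auto simp: take_Suc_conv_app_nth)

lemma ups_add:
  assumes "m \<le> length w"
  shows "ups w (s + m) = ups w s + count_list (take m (rotate s w)) Up"
proof -
  have "ups w (s + m) = ups w s + (\<Sum>a<m. of_bool (w ! ((s + a) mod length w) = Up))"
    by (induction m) (auto simp: ups_def)
  also have "(\<Sum>a<m. of_bool (w ! ((s + a) mod length w) = Up))
      = (\<Sum>a<m. of_bool (rotate s w ! a = Up) :: nat)"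
    using assms by (intro sum.cong) (auto simp: nth_rotate add.commute)
  finally show ?thesis
    using assms by (simp add: count_take)
qed

section \<open>The condition on the divisible points\<close>

lemma path_point_take:
  "path_point ((0, h), w) m = (int (length (take m w)), h + 2 * int (count_list (take m w) Up) - int (length (take m w)))"
proof -
  have "(\<Sum>s\<leftarrow>v. fst (step_vec s)) = int (length v) \<and>
        (\<Sum>s\<leftarrow>v. snd (step_vec s)) = 2 * int (count_list v Up) - int (length v)" for v
  proof (induction v)
    case (Cons s v)
    then show ?case by (cases s) auto
  qed simp
  then show ?thesis by (simp add: path_point_def)
qed

text \<open>The slope is chosen so that lying above the line means \<open>u - m - i > m / n\<close>, where the left side
  is an integer and the right side is strictly between 0 and 1.\<close>

lemma above_line_iff:
  fixes k n m u :: nat and i :: int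
  assumes k: "k > 0" and m: "0 < m" "m < n"
  shows "strictly_above_line (line_slope k n) (int (k * m), - 2 * i + 2 * int u - int (k * m))
     \<longleftrightarrow> i < int u - int m"
proof -
  have slope: "line_slope k n * real (k * m) = 2 * real m - real (k * m) + 2 * (real m / real n)"
    using k m by (simp add: line_slope_def field_simps)
  have "strictly_above_line (line_slope k n) (int (k * m), - 2 * i + 2 * int u - int (k * m))
     \<longleftrightarrow> line_slope k n * real (k * m) < - 2 * real_of_int i + 2 * real u - real (k * m)"
    by (simp add: strictly_above_line_def)
  also have "\<dots> \<longleftrightarrow> real m / real n < real_of_int (int u - int m - i)"
    unfolding slope of_int_diff of_int_of_nat_eq by linarith
  also have "\<dots> \<longleftrightarrow> 0 < int u - int m - i"
  proof -
    have "0 < real m / real n" "real m / real n < 1"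
      using m by auto
    then show ?thesis by linarith
  qed
  finally show ?thesis by linarith
qed

definition admissible :: "nat \<Rightarrow> nat \<Rightarrow> step list \<Rightarrow> int \<Rightarrow> bool" where
  "admissible k n w i \<longleftrightarrow> (\<forall>m. 0 < m \<and> m < n \<longrightarrow> i < int (count_list (take (k * m) w) Up) - int m)"

lemma paths_from_iff:
  assumes k: "k > 0"
  shows "p \<in> paths_from j k n i \<longleftrightarrow>
    initial_point p = (0, -2 * i) \<and> path_steps p \<in> words (k * n) (n + j) \<and> admissible k n (path_steps p) i"
proof -
  obtain q w where p: "p = (q, w)" by (cases p)
  have steps: "int (count_list w Up) = int n + int j \<and>
      int (count_list w Down) = int k * int n - (int n + int j) \<longleftrightarrow> w \<in> words (k * n) (n + j)"
    using count_Up_Down[of w] unfolding words_def by (auto simp flip: of_nat_mult of_nat_add)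
  have "(\<forall>P\<in>interior_divisible_points k ((0, -2 * i), w). strictly_above_line (line_slope k n) P)
      \<longleftrightarrow> admissible k n w i" if len: "length w = k * n"
  proof -
    have "(\<forall>P\<in>interior_divisible_points k ((0, -2 * i), w). strictly_above_line (line_slope k n) P)
      \<longleftrightarrow> (\<forall>m. 0 < m \<and> m < n \<longrightarrow>
            strictly_above_line (line_slope k n) (path_point ((0, -2 * i), w) (k * m)))"
    proof -
      have "interior_divisible_points k ((0, -2 * i), w)
          = (\<lambda>m. path_point ((0, -2 * i), w) (k * m)) ` {0<..<n}"
        using k len unfolding interior_divisible_points_def by auto
      then show ?thesis
        by (simp only: ball_simps) auto
    qed
    also have "\<dots> \<longleftrightarrow> admissible k n w i"
      unfolding admissible_def
    proof (intro all_cong)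
      fix m assume m: "0 < m \<and> m < n"
      then have "length (take (k * m) w) = k * m"
        using len by simp
      then show "strictly_above_line (line_slope k n) (path_point ((0, -2 * i), w) (k * m))
          \<longleftrightarrow> i < int (count_list (take (k * m) w) Up) - int m"
        unfolding path_point_take using above_line_iff[OF k] m by simp
    qed
    finally show ?thesis .
  qed
  then show ?thesis
    using steps unfolding paths_from_def p by (auto simp: words_def)
qed

section \<open>The count\<close>

lemma sum_rotations:
  assumes n: "n > 0" and w: "w \<in> words (k * n) (n + j)"
  shows "(\<Sum>t = 1..n. card {i. 0 \<le> i \<and> i < int j \<and> admissible k n (rotate (k * t) w) i}) = j"
proof -
  define S where "S m = int (ups w (k * m)) - int m" for m
  have len: "length w = k * n" and cnt: "count_list w Up = n + j"
    using w by (auto simp: words_def)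
  have "S (m + n) = S m + int j" for m
  proof -
    have "take (k * n) (rotate (k * m) w) = rotate (k * m) w"
      using len by simp
    moreover have "count_list (rotate (k * m) w) Up = n + j"
      using cnt by (simp add: count_list_rotate)
    ultimately show ?thesis
      using ups_add[of "k * n" w "k * m"] len by (simp add: S_def distrib_left)
  qed
  moreover have "admissible k n (rotate (k * t) w) i \<longleftrightarrow>
      (\<forall>m. 0 < m \<and> m < n \<longrightarrow> i < S (t + m) - S t)" for t i
    unfolding admissible_def
  proof (intro all_cong)
    fix m assume "0 < m \<and> m < n"
    then show "i < int (count_list (take (k * m) (rotate (k * t) w)) Up) - int m \<longleftrightarrow> i < S (t + m) - S t"
      using ups_add[of "k * m" w "k * t"] len by (simp add: S_def distrib_left)
  qed
  ultimately show ?thesis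
    using sum_positive_margins[OF n, of S j] by simp
qed

theorem mainTheorem1:
  fixes j k n :: nat
  assumes "j \<ge> 1" and "k \<ge> 2" and "real n \<ge> real j / (real k - 1)"
  shows "real (card {p. \<exists>i::int. i \<ge> 0 \<and> i < int j \<and> p \<in> paths_from j k n i})
           = real j / real n * real ((k * n) choose (n + j))"
proof -
  have "0 < real j / (real k - 1)"
    using assms by (intro divide_pos_pos) auto
  then have n: "n > 0" using assms(3) by (cases n) auto
  have k: "k > 0" using assms(2) by simp
  define W where "W = words (k * n) (n + j)"
  define c where "c w = card {i. 0 \<le> i \<and> i < int j \<and> admissible k n w i}" for w
  let ?P = "SIGMA w:W. {i. 0 \<le> i \<and> i < int j \<and> admissible k n w i}"
  have "{p. \<exists>i::int. i \<ge> 0 \<and> i < int j \<and> p \<in> paths_from j k n i} = (\<lambda>(w, i). ((0, -2 * i), w)) ` ?P"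
    unfolding paths_from_iff[OF k] W_def by force
  moreover have "inj_on (\<lambda>(w, i). ((0 :: int, -2 * i :: int), w)) ?P"
    by (auto simp: inj_on_def)
  ultimately have "card {p. \<exists>i::int. i \<ge> 0 \<and> i < int j \<and> p \<in> paths_from j k n i} = card ?P"
    by (simp add: card_image)
  also have "\<dots> = (\<Sum>w\<in>W. c w)"
    unfolding c_def W_def
    by (subst card_SigmaI) (auto simp: finite_words intro: finite_subset[of _ "{0..<int j}"])
  finally have count: "card {p. \<exists>i::int. i \<ge> 0 \<and> i < int j \<and> p \<in> paths_from j k n i} = (\<Sum>w\<in>W. c w)" .
  have "n * (\<Sum>w\<in>W. c w) = (\<Sum>t = 1..n. \<Sum>w\<in>W. c (rotate (k * t) w))"
    unfolding W_def by (simp add: sum.reindex_bij_betw[OF bij_betw_rotate_words])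
  also have "\<dots> = (\<Sum>w\<in>W. \<Sum>t = 1..n. c (rotate (k * t) w))"
    by (rule sum.swap)
  also have "\<dots> = (\<Sum>w\<in>W. j)"
    using sum_rotations[OF n] by (intro sum.cong) (auto simp: c_def W_def)
  also have "\<dots> = j * ((k * n) choose (n + j))"
    by (simp add: W_def card_words)
  finally have "real n * real (\<Sum>w\<in>W. c w) = real j * real ((k * n) choose (n + j))"
    by (simp only: flip: of_nat_mult)
  then show ?thesis
    unfolding count using n by (simp add: field_simps)
qed

end
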